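(* Let $a\in\mathbb{R}$ with $a>0$, and let $f:(a,\infty)\to\mathbb{R}$ be a function. If $\lim\limits_{x\to\infty} f(x)=1$, then $$\Gamma(x+1)\sim \sqrt{2\pi x}\,\left(\frac{x}{e}\right)^x f(x)\qquad (x\to\infty).$$
   Context: Here $\Gamma$ is the Euler gamma function, and $x$ is a real variable. The notation $g(x)\sim h(x)$ (as $x\to\infty$) means that $g$ is asymptotic to $h$, i.e. $\lim_{x\to\infty} g(x)/h(x)=1$. *)

theory Defs
  imports "HOL-Analysis.Analysis" "HOL-Library.Landau_Symbols" "HOL-Library.FuncSet"
begin

end

theory Submission
  imports Defs "HOL-Real_Asymp.Real_Asymp"
begin

text \<open>
  Since \<open>f\<close> tends to \<open>1\<close>, the claim is Stirling's formula for real arguments. It is proved by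
  taking logarithms and showing that the remainder
  \<open>h x = ln_Gamma x - ((x - 1/2) * ln x - x)\<close> tends to \<open>ln (2 * pi) / 2\<close>.

  Convergence comes in two steps. By the functional equation,
  \<open>h (x + 1) - h x = 1 - (x + 1/2) * ln (1 + 1/x)\<close> is of order \<open>1 / x\<^sup>2\<close>, hence summable along the
  integers, so \<open>h\<close> converges along the integers (\<open>convergent_stirling_remainder_of_nat\<close>). Between
  consecutive integers \<open>h\<close> hardly moves: log-convexity of \<open>Gamma\<close> puts \<open>Digamma x\<close> between
  \<open>ln x - 1 / x\<close> and \<open>ln x\<close>, which gives \<open>\<bar>h' x\<bar> \<le> 1 / (2 * x)\<close>. So \<open>h\<close> has the same limit along
  the reals (\<open>convergent_stirling_remainder\<close>).

  If \<open>C\<close> is this limit, then \<open>h x + h (x + 1/2) - h (2 * x)\<close> also tends to \<open>C\<close>; but Legendre's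
  duplication formula eliminates the Gamma function from this combination and leaves an elementary
  function, whose limit is \<open>ln (2 * pi) / 2\<close>.
\<close>

definition stirling_remainder :: "real \<Rightarrow> real" where
  "stirling_remainder x = ln_Gamma x - ((x - 1/2) * ln x - x)"

lemma ln_Gamma_real_plus1:
  fixes x :: real
  assumes "x > 0"
  shows "ln_Gamma (x + 1) = ln_Gamma x + ln x"
proof -
  have "Gamma (x + 1) = x * Gamma x"
    using assms by (intro Gamma_plus1) (auto elim!: nonpos_Ints_cases)
  moreover have "Gamma x \<noteq> 0"
    using Gamma_real_pos[OF assms] by simp
  ultimately show ?thesis
    using assms by (simp add: ln_Gamma_real_pos ln_mult)
qed

lemma stirling_remainder_plus1:
  assumes "x > 0"
  shows "stirling_remainder (x + 1) - stirling_remainder x = 1 - (x + 1/2) * ln (1 + 1/x)"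
proof -
  have "ln (1 + 1/x) = ln (x + 1) - ln x"
    using assms ln_div[of "x + 1" x] by (simp add: field_simps)
  thus ?thesis
    unfolding stirling_remainder_def ln_Gamma_real_plus1[OF assms]
    by (simp only:) (simp add: field_simps)
qed

text \<open>
  In the expansion of \<open>(x + 1/2) * ln (1 + 1/x)\<close> the constant term is \<open>1\<close> and the shift \<open>1/2\<close>
  makes the terms in \<open>1 / x\<close> cancel, so the increments of the remainder are of order \<open>1 / x\<^sup>2\<close> and their telescoping series converges.
\<close>
lemma convergent_stirling_remainder_of_nat: "convergent (\<lambda>n. stirling_remainder (real n))"
proof -
  have "(\<lambda>n. 1 - (real n + 1/2) * ln (1 + 1 / real n)) \<in> O(\<lambda>n. 1 / real n ^ 2)"
    by real_asymp
  moreover have "summable (\<lambda>n. norm (1 / real n ^ 2))"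
    using inverse_power_summable[of 2, where 'a = real] by (simp add: field_simps)
  ultimately have "summable (\<lambda>n. 1 - (real n + 1/2) * ln (1 + 1 / real n))"
    by (rule summable_comparison_test_bigo[rotated])
  \<comment> \<open>The terms may differ at \<open>n = 0\<close>, where the recurrence is not available.\<close>
  also have "?this \<longleftrightarrow> summable (\<lambda>n. stirling_remainder (real (Suc n)) - stirling_remainder (real n))"
  proof (rule summable_cong)
    show "\<forall>\<^sub>F n in sequentially. 1 - (real n + 1/2) * ln (1 + 1 / real n) =
            stirling_remainder (real (Suc n)) - stirling_remainder (real n)"
      using eventually_gt_at_top[of 0]
    proof eventually_elim
      case (elim n)
      thus ?case
        using stirling_remainder_plus1[of "real n"] by (simp add: add.commute)
    qed
  qed
  finally have "convergent (\<lambda>n. \<Sum>k<n. stirling_remainder (real (Suc k)) - stirling_remainder (real k))"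
    by (simp add: summable_iff_convergent)
  hence "convergent (\<lambda>n. stirling_remainder (real n) - stirling_remainder 0)"
    by (subst (asm) sum_lessThan_telescope) simp
  thus ?thesis
    by (simp add: convergent_diff_const_right_iff)
qed

text \<open>
  The increment \<open>ln_Gamma (x + 1) - ln_Gamma x = ln x\<close> is a value of \<open>Digamma\<close> between \<open>x\<close> and
  \<open>x + 1\<close>, and \<open>Digamma\<close> is increasing.
\<close>
lemma Digamma_real_ln_bounds:
  fixes x :: real
  assumes "x > 0"
  shows "Digamma x \<le> ln x" and "ln x \<le> Digamma x + 1 / x"
proof -
  obtain z where z: "x < z" "z < x + 1" "ln_Gamma (x + 1) - ln_Gamma x = (x + 1 - x) * Digamma z"
    using MVT2[of x "x + 1" ln_Gamma Digamma] has_field_derivative_ln_Gamma_real assms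
    by fastforce
  have "Digamma z = ln x"
    using z assms by (simp add: ln_Gamma_real_plus1)
  moreover have "Digamma x \<le> Digamma z" "Digamma z \<le> Digamma (x + 1)"
    using z assms by (auto intro!: Digamma_real_mono)
  moreover have "Digamma (x + 1) = Digamma x + 1 / x"
    using assms by (subst Digamma_plus1) auto
  ultimately show "Digamma x \<le> ln x" and "ln x \<le> Digamma x + 1 / x"
    by auto
qed

text \<open>
  The derivative of the remainder is \<open>Digamma t - ln t + 1 / (2 * t)\<close>. The correction term
  \<open>1 / (2 * t)\<close> centres the interval \<open>[- 1 / t, 0]\<close> that contains \<open>Digamma t - ln t\<close>.
\<close>
lemma abs_stirling_remainder_diff_le:
  assumes "0 < m" "m \<le> x" "x \<le> m + 1"
  shows "\<bar>stirling_remainder x - stirling_remainder m\<bar> \<le> 1 / (2 * m)"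
proof (cases "x = m")
  case False
  have deriv: "(stirling_remainder has_real_derivative Digamma t - ln t + 1 / (2 * t)) (at t)"
    if "t > 0" for t
    unfolding stirling_remainder_def [abs_def] using that
    by (auto intro!: derivative_eq_intros simp: field_simps)
  obtain z where z: "m < z" "z < x"
    "stirling_remainder x - stirling_remainder m = (x - m) * (Digamma z - ln z + 1 / (2 * z))"
    using MVT2[of m x stirling_remainder "\<lambda>t. Digamma t - ln t + 1 / (2 * t)"] deriv assms False
    by auto
  have "1 / (2 * z) = 1 / z - 1 / (2 * z)"
    by simp
  hence "\<bar>Digamma z - ln z + 1 / (2 * z)\<bar> \<le> 1 / (2 * z)"
    using Digamma_real_ln_bounds[of z] z assms by linarith
  also have "\<dots> \<le> 1 / (2 * m)"
    using z assms by (intro divide_left_mono) auto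
  finally have "\<bar>(x - m) * (Digamma z - ln z + 1 / (2 * z))\<bar> \<le> 1 * (1 / (2 * m))"
    unfolding abs_mult using assms by (intro mult_mono) auto
  thus ?thesis
    using z by simp
qed (use assms in auto)

lemma convergent_stirling_remainder: "\<exists>C. (stirling_remainder \<longlongrightarrow> C) at_top"
proof -
  obtain C where C: "(\<lambda>n. stirling_remainder (real n)) \<longlonglongrightarrow> C"
    using convergent_stirling_remainder_of_nat by (auto simp: convergent_def)
  have floor: "filterlim (\<lambda>x::real. nat \<lfloor>x\<rfloor>) sequentially at_top"
    by (intro filterlim_compose[OF filterlim_nat_sequentially] filterlim_floor_sequentially)
  have int_part: "((\<lambda>x::real. stirling_remainder (real (nat \<lfloor>x\<rfloor>))) \<longlongrightarrow> C) at_top"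
    by (rule filterlim_compose[OF C floor])
  have frac_part: "((\<lambda>x. stirling_remainder x - stirling_remainder (real (nat \<lfloor>x\<rfloor>))) \<longlongrightarrow> 0) at_top"
  proof (rule Lim_null_comparison)
    show "((\<lambda>x::real. 1 / (2 * real (nat \<lfloor>x\<rfloor>))) \<longlongrightarrow> 0) at_top"
      by (rule filterlim_compose[OF _ floor]) real_asymp
    show "\<forall>\<^sub>F x in at_top. norm (stirling_remainder x - stirling_remainder (real (nat \<lfloor>x\<rfloor>)))
            \<le> 1 / (2 * real (nat \<lfloor>x\<rfloor>))"
      using eventually_ge_at_top[of "1::real"]
    proof eventually_elim
      case (elim x)
      hence "real (nat \<lfloor>x\<rfloor>) = of_int \<lfloor>x\<rfloor>" "\<lfloor>x\<rfloor> \<ge> 1"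
        by auto
      thus ?case
        unfolding real_norm_def
        by (intro abs_stirling_remainder_diff_le) linarith+
    qed
  qed
  show ?thesis
    using tendsto_add[OF frac_part int_part] by auto
qed

text \<open>Both sides of the complex formula are real at real arguments.\<close>
lemma Gamma_legendre_duplication_real:
  fixes x :: real
  assumes "x > 0"
  shows "Gamma x * Gamma (x + 1/2) = exp ((1 - 2 * x) * ln 2) * sqrt pi * Gamma (2 * x)"
proof -
  have pos: "of_real t \<notin> (\<int>\<^sub>\<le>\<^sub>0 :: complex set)" if "t > 0" for t :: real
    using that by (auto simp: nonpos_Ints_def complex_eq_iff)
  have "complex_of_real x + 1/2 = of_real (x + 1/2)"
    by simp
  moreover have "complex_of_real x \<notin> \<int>\<^sub>\<le>\<^sub>0" "complex_of_real (x + 1/2) \<notin> \<int>\<^sub>\<le>\<^sub>0"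
    using assms by (intro pos; simp)+
  ultimately have "Gamma (complex_of_real x) * Gamma (of_real (x + 1/2)) =
          exp ((1 - 2 * of_real x) * of_real (ln 2)) * of_real (sqrt pi) * Gamma (2 * of_real x)"
    using Gamma_legendre_duplication[of "of_real x"] by (simp only: not_False_eq_True)
  also have "(1 - 2 * complex_of_real x) * of_real (ln 2) = of_real ((1 - 2 * x) * ln 2)"
    by simp
  also have "2 * complex_of_real x = of_real (2 * x)"
    by simp
  finally have "complex_of_real (Gamma x * Gamma (x + 1/2)) =
                  of_real (exp ((1 - 2 * x) * ln 2) * sqrt pi * Gamma (2 * x))"
    unfolding Gamma_complex_of_real exp_of_real by (simp only: of_real_mult)
  thus ?thesis
    by (simp only: of_real_eq_iff)
qed

text \<open>
  In the combination below the three Gamma values cancel, by the duplication formula, up to the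
  factor \<open>exp ((1 - 2 * x) * ln 2) * sqrt pi\<close>.
\<close>
lemma stirling_remainder_duplication:
  assumes "x > 0"
  shows "stirling_remainder x + stirling_remainder (x + 1/2) - stirling_remainder (2 * x) =
           ln (2 * pi) / 2 + (1/2 - x * ln (1 + 1 / (2 * x)))"
proof -
  have "ln (Gamma x * Gamma (x + 1/2)) = ln (exp ((1 - 2 * x) * ln 2) * sqrt pi * Gamma (2 * x))"
    using Gamma_legendre_duplication_real[OF assms] by simp
  hence "ln_Gamma x + ln_Gamma (x + 1/2) = (1 - 2 * x) * ln 2 + ln pi / 2 + ln_Gamma (2 * x)"
    using assms by (simp add: ln_Gamma_real_pos ln_mult ln_powr ln_sqrt Gamma_real_pos[THEN less_imp_neq, symmetric])
  moreover have "ln (1 + 1 / (2 * x)) = ln (x + 1/2) - ln x"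
    using assms ln_div[of "x + 1/2" x] by (simp add: field_simps)
  ultimately show ?thesis
    using assms by (simp add: stirling_remainder_def ln_mult) (simp add: field_simps)
qed

lemma tendsto_stirling_remainder: "(stirling_remainder \<longlongrightarrow> ln (2 * pi) / 2) at_top"
proof -
  obtain C where C: "(stirling_remainder \<longlongrightarrow> C) at_top"
    using convergent_stirling_remainder by blast
  have half: "filterlim (\<lambda>x::real. x + 1/2) at_top at_top"
    and double: "filterlim (\<lambda>x::real. 2 * x) at_top at_top"
    by real_asymp+
  have "((\<lambda>x. stirling_remainder x + stirling_remainder (x + 1/2) - stirling_remainder (2 * x))
           \<longlongrightarrow> C + C - C) at_top"
    by (intro tendsto_intros C filterlim_compose[OF C half] filterlim_compose[OF C double])
  moreover have "((\<lambda>x. stirling_remainder x + stirling_remainder (x + 1/2) - stirling_remainder (2 * x))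
           \<longlongrightarrow> ln (2 * pi) / 2) at_top"
  proof (rule Lim_transform_eventually)
    have "((\<lambda>x::real. 1/2 - x * ln (1 + 1 / (2 * x))) \<longlongrightarrow> 0) at_top"
      by real_asymp
    from tendsto_add[OF tendsto_const this]
    show "((\<lambda>x. ln (2 * pi) / 2 + (1/2 - x * ln (1 + 1 / (2 * x)))) \<longlongrightarrow> ln (2 * pi) / 2) at_top"
      by simp
    show "\<forall>\<^sub>F x in at_top. ln (2 * pi) / 2 + (1/2 - x * ln (1 + 1 / (2 * x))) =
            stirling_remainder x + stirling_remainder (x + 1/2) - stirling_remainder (2 * x)"
      using eventually_gt_at_top[of 0]
      by eventually_elim (rule stirling_remainder_duplication[symmetric])
  qed
  ultimately have "C + C - C = ln (2 * pi) / 2"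
    by (rule tendsto_unique[OF trivial_limit_at_top_linorder])
  hence "C = ln (2 * pi) / 2"
    by simp
  with C show ?thesis
    by simp
qed

lemma Gamma_plus1_eq_stirling_remainder:
  assumes "x > 0"
  shows "Gamma (x + 1) = sqrt x * (x / exp 1) powr x * exp (stirling_remainder x)"
proof -
  have "sqrt x = exp (ln x / 2)"
    using assms by (simp add: powr_half_sqrt[symmetric] powr_def)
  moreover have "(x / exp 1) powr x = exp (x * (ln x - 1))"
    using assms by (simp add: powr_def ln_div)
  moreover have "Gamma (x + 1) = exp (ln_Gamma x + ln x)"
    using assms by (simp add: Gamma_real_pos_exp ln_Gamma_real_plus1)
  ultimately show ?thesis
    by (simp add: stirling_remainder_def exp_add[symmetric] algebra_simps)
qed

theorem stirling_Gamma_real: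
  "(\<lambda>x::real. Gamma (x + 1)) \<sim>[at_top] (\<lambda>x. sqrt (2 * pi * x) * (x / exp 1) powr x)"
proof -
  have "((\<lambda>x. exp (stirling_remainder x)) \<longlongrightarrow> exp (ln (2 * pi) / 2)) at_top"
    by (intro tendsto_exp tendsto_stirling_remainder)
  moreover have "exp (ln (2 * pi) / 2) = sqrt (2 * pi)"
    by (simp add: powr_half_sqrt[symmetric] powr_def)
  ultimately have "(\<lambda>x. exp (stirling_remainder x)) \<sim>[at_top] (\<lambda>_. sqrt (2 * pi))"
    by (intro tendsto_imp_asymp_equiv_const) auto
  hence "(\<lambda>x. sqrt x * (x / exp 1) powr x * exp (stirling_remainder x)) \<sim>[at_top]
           (\<lambda>x. sqrt x * (x / exp 1) powr x * sqrt (2 * pi))"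
    by (intro asymp_equiv_intros)
  also have "(\<lambda>x. sqrt x * (x / exp 1) powr x * sqrt (2 * pi)) =
               (\<lambda>x. sqrt (2 * pi * x) * (x / exp 1) powr x)"
    by (simp add: real_sqrt_mult mult_ac)
  finally show ?thesis
  proof (rule asymp_equiv_transfer)
    show "\<forall>\<^sub>F x in at_top. sqrt x * (x / exp 1) powr x * exp (stirling_remainder x) = Gamma (x + 1)"
      using eventually_gt_at_top[of 0]
      by eventually_elim (rule Gamma_plus1_eq_stirling_remainder[symmetric])
  qed auto
qed

theorem theorem2p1:
  fixes a :: real and f :: "real \<Rightarrow> real"
  assumes "a > 0"
    and "f \<in> {a<..} \<rightarrow> UNIV"
    and "(f \<longlongrightarrow> 1) at_top"
  shows "(\<lambda>x. Gamma (x + 1)) \<sim>[at_top] (\<lambda>x. sqrt (2 * pi * x) * (x / exp 1) powr x * f x)"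
proof -
  have "f \<sim>[at_top] (\<lambda>_. 1)"
    using assms(3) by (intro tendsto_imp_asymp_equiv_const) auto
  from asymp_equiv_mult[OF stirling_Gamma_real asymp_equiv_symI[OF this]]
  show ?thesis
    by simp
qed

end
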